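(* Let $A$ be a $C^*$-algebra and let $u, v \in A$ be partial isometries. Then $$\|u^*u - v^*v\| \le \|u - v\|.$$
   Context: A partial isometry in a $C^*$-algebra is an element $u$ such that $u^*u$ is a projection (equivalently $uu^*u = u$). The $C^*$-algebra is not assumed to be unital. *)

theory Defs
  imports "HOL-Analysis.Analysis"
begin

text \<open>Complex Banach algebras, not assumed to be unital. The real structure of the library
  classes is required to be the restriction of the complex one.\<close>

class complex_banach_algebra = real_normed_algebra + banach +
  fixes scaleC :: "complex \<Rightarrow> 'a \<Rightarrow> 'a"  (infixr \<open>*\<^sub>C\<close> 75)
  assumes scaleC_of_real: "complex_of_real r *\<^sub>C x = r *\<^sub>R x"
    and scaleC_add_right: "c *\<^sub>C (x + y) = c *\<^sub>C x + c *\<^sub>C y"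
    and scaleC_add_left: "(c + d) *\<^sub>C x = c *\<^sub>C x + d *\<^sub>C x"
    and scaleC_scaleC: "c *\<^sub>C d *\<^sub>C x = (c * d) *\<^sub>C x"
    and norm_scaleC: "norm (c *\<^sub>C x) = cmod c * norm x"
    and mult_scaleC_left: "(c *\<^sub>C x) * y = c *\<^sub>C (x * y)"
    and mult_scaleC_right: "x * (c *\<^sub>C y) = c *\<^sub>C (x * y)"

class cstar_algebra = complex_banach_algebra +
  fixes star :: "'a \<Rightarrow> 'a"  (\<open>(_\<^sup>\<star>)\<close> [1000] 999)
  assumes star_star: "(x\<^sup>\<star>)\<^sup>\<star> = x"
    and star_add: "(x + y)\<^sup>\<star> = x\<^sup>\<star> + y\<^sup>\<star>"
    and star_scaleC: "(c *\<^sub>C x)\<^sup>\<star> = cnj c *\<^sub>C x\<^sup>\<star>"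
    and star_mult: "(x * y)\<^sup>\<star> = y\<^sup>\<star> * x\<^sup>\<star>"
    and cstar_identity: "norm (x\<^sup>\<star> * x) = (norm x)\<^sup>2"

instantiation complex :: cstar_algebra
begin

definition scaleC_complex :: "complex \<Rightarrow> complex \<Rightarrow> complex" where
  "scaleC_complex = (*)"

definition star_complex :: "complex \<Rightarrow> complex" where
  "star_complex = cnj"

instance
  by standard
    (auto simp: scaleC_complex_def star_complex_def scaleR_conv_of_real algebra_simps
       norm_mult power2_eq_square)

end

definition projection :: "'a::cstar_algebra \<Rightarrow> bool" where
  "projection p \<longleftrightarrow> p * p = p \<and> p\<^sup>\<star> = p"

definition partial_isometry :: "'a::cstar_algebra \<Rightarrow> bool" where
  "partial_isometry u \<longleftrightarrow> projection (u\<^sup>\<star> * u)"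

end

(* With the projections p = u^* u and q = v^* v one has (p - q)^2 = a + b, where
   a = (p - pq)(p - pq)^* and b = (q - pq)(q - pq)^* are self-adjoint and orthogonal, so that
   |p - q| is at most the maximum of |p - pq| and |q - qp|.
   Since v = vq, the first of these is |u^*(w - wq)| with w = u - v, and this is at most |w|;
   the second one is symmetric. *)

theory Submission
  imports Defs
begin

lemma star_diff: "(x - y)\<^sup>\<star> = x\<^sup>\<star> - (y\<^sup>\<star> :: 'a::cstar_algebra)"
proof -
  interpret additive "star :: 'a \<Rightarrow> 'a"
    by standard (rule star_add)
  show ?thesis
    by (rule diff)
qed

lemma norm_star: "norm (x\<^sup>\<star>) = norm (x :: 'a::cstar_algebra)"
proof -
  have le: "norm y \<le> norm (y\<^sup>\<star>)" for y :: 'a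
  proof (cases "norm y = 0")
    case False
    have "norm y * norm y \<le> norm (y\<^sup>\<star>) * norm y"
      using norm_mult_ineq[of "y\<^sup>\<star>" y] by (simp add: cstar_identity power2_eq_square)
    with False show ?thesis
      by simp
  qed simp
  show ?thesis
    using le[of x] le[of "x\<^sup>\<star>"] by (simp add: star_star)
qed

lemma norm_mult_star: "norm (x * x\<^sup>\<star>) = (norm (x :: 'a::cstar_algebra))\<^sup>2"
  using cstar_identity[of "x\<^sup>\<star>"] by (simp add: star_star norm_star)

lemma norm_projection_le_1:
  assumes "projection p"
  shows "norm p \<le> 1"
proof -
  have "norm p * norm p = norm p"
    using assms cstar_identity[of p] by (simp add: projection_def power2_eq_square)
  then show ?thesis
    by auto
qed

text \<open>A unit-free substitute for multiplying by the contraction 1 - q. For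
  \<open>z = w - w * q\<close> one has \<open>q * z\<^sup>\<star> = 0\<close>, hence
  \<open>z * z\<^sup>\<star> = w * z\<^sup>\<star>\<close>, and one factor \<open>norm z\<close>
  cancels.\<close>

lemma norm_diff_mult_projection_le:
  assumes "projection q"
  shows "norm (w - w * q) \<le> norm w"
proof (cases "norm (w - w * q) = 0")
  case False
  let ?z = "w - w * q"
  have q: "q * q = q" "q\<^sup>\<star> = q"
    using assms by (auto simp: projection_def)
  have "q * ?z\<^sup>\<star> = q * w\<^sup>\<star> - (q * q) * w\<^sup>\<star>"
    by (simp add: star_diff star_mult q(2) right_diff_distrib mult.assoc)
  then have "q * ?z\<^sup>\<star> = 0"
    by (simp add: q)
  then have "?z * ?z\<^sup>\<star> = w * ?z\<^sup>\<star>"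
    by (simp add: left_diff_distrib mult.assoc)
  then have "norm ?z * norm ?z \<le> norm w * norm ?z"
    using norm_mult_star[of ?z] norm_mult_ineq[of w "?z\<^sup>\<star>"]
    by (simp add: norm_star power2_eq_square)
  with False show ?thesis
    by simp
qed simp

text \<open>With \<open>p = u\<^sup>\<star> * u\<close>, the product
  \<open>(u - u * p)\<^sup>\<star> * (u - u * p)\<close> expands to p - p - p + p = 0, so the
  C*-identity forces \<open>u - u * p = 0\<close>.\<close>

lemma partial_isometry_mult_support:
  assumes "partial_isometry u"
  shows "u * (u\<^sup>\<star> * u) = u"
proof -
  define p where "p = u\<^sup>\<star> * u"
  have p: "p * p = p" "p\<^sup>\<star> = p"
    using assms by (auto simp: p_def partial_isometry_def projection_def)
  have "(u - u * p)\<^sup>\<star> * (u - u * p)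
      = u\<^sup>\<star> * u - (u\<^sup>\<star> * u) * p - p * (u\<^sup>\<star> * u) + p * (u\<^sup>\<star> * u) * p"
    by (simp add: star_diff star_mult p algebra_simps)
  also have "\<dots> = 0"
    by (simp add: p flip: p_def)
  finally have "norm (u - u * p) = 0"
    using cstar_identity[of "u - u * p"] by simp
  then show ?thesis
    by (simp add: p_def)
qed

lemma norm_partial_isometry_le_1:
  assumes "partial_isometry u"
  shows "norm u \<le> 1"
proof -
  have "(norm u)\<^sup>2 \<le> 1"
    using assms norm_projection_le_1[of "u\<^sup>\<star> * u"]
    by (simp add: partial_isometry_def cstar_identity)
  then show ?thesis
    by (simp add: abs_square_le_1)
qed

text \<open>A constant factor disappears under 2^n-th roots. This removes the factor 2 that the
  triangle inequality costs when two orthogonal elements are added.\<close>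

lemma le_if_powers_le_twice:
  fixes t M :: real
  assumes "0 \<le> M" and le: "\<And>n::nat. t ^ 2 ^ n \<le> 2 * M ^ 2 ^ n"
  shows "t \<le> M"
proof (rule ccontr)
  assume "\<not> t \<le> M"
  \<comment> \<open>The case n = 0 reads t \<le> 2M, so M = 0 would give t \<le> M.\<close>
  moreover have "M \<noteq> 0"
    using calculation le[of 0] by auto
  ultimately have M: "0 < M" "1 < t / M"
    using \<open>0 \<le> M\<close> by auto
  obtain n where n: "2 < (t / M) ^ n"
    using real_arch_pow[OF M(2)] by blast
  also have "\<dots> \<le> (t / M) ^ 2 ^ n"
    using M(2) by (intro power_increasing) (auto intro: less_imp_le)
  also have "\<dots> \<le> 2"
    using le[of n] M(1) by (simp add: power_divide field_simps)
  finally show False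
    by simp
qed

(* Induction by squaring, (a + b)^2 = a^2 + b^2 with a^2, b^2 orthogonal again, since without
   a unit the power operator is not available in the algebra. *)
lemma norm_orthogonal_add_power_le:
  fixes a b :: "'a::cstar_algebra"
  assumes "a\<^sup>\<star> = a" "b\<^sup>\<star> = b" "a * b = 0" "b * a = 0" "norm a \<le> M" "norm b \<le> M"
  shows "norm (a + b) ^ 2 ^ n \<le> 2 * M ^ 2 ^ n"
  using assms
proof (induction n arbitrary: a b M)
  case 0
  then show ?case
    using norm_triangle_ineq[of a b] by simp
next
  case (Suc n)
  \<comment> \<open>As a + b is self-adjoint, the C*-identity equates the squared norm with the norm
    of the square, whose cross terms vanish.\<close>
  have sq: "(norm (a + b))\<^sup>2 = norm (a * a + b * b)"
    using cstar_identity[of "a + b"] Suc.prems by (simp add: star_add distrib_left distrib_right)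
  have bound: "norm (c * c) \<le> M\<^sup>2" if "norm c \<le> M" for c :: 'a
    using norm_mult_ineq[of c c] power_mono[OF that, of 2] by (simp add: power2_eq_square)
  have orth: "(c * c) * (d * d) = 0" if "c * d = 0" for c d :: 'a
  proof -
    have "(c * c) * (d * d) = c * (c * d) * d"
      by (simp only: mult.assoc)
    then show ?thesis
      by (simp add: that)
  qed
  have "norm (a * a + b * b) ^ 2 ^ n \<le> 2 * (M\<^sup>2) ^ 2 ^ n"
    by (rule Suc.IH) (use Suc.prems in \<open>simp_all add: star_mult bound orth\<close>)
  then show ?case
    by (simp add: power_mult flip: sq)
qed

lemma norm_orthogonal_add_le:
  fixes a b :: "'a::cstar_algebra"
  assumes "a\<^sup>\<star> = a" "b\<^sup>\<star> = b" "a * b = 0" "b * a = 0" "norm a \<le> M" "norm b \<le> M"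
  shows "norm (a + b) \<le> M"
proof (rule le_if_powers_le_twice)
  show "0 \<le> M"
    using assms(5) norm_ge_zero order_trans by blast
  show "norm (a + b) ^ 2 ^ n \<le> 2 * M ^ 2 ^ n" for n
    using assms by (rule norm_orthogonal_add_power_le)
qed

lemma norm_projection_diff_le:
  fixes p q :: "'a::cstar_algebra"
  assumes "projection p" "projection q" and x: "norm (p - p * q) \<le> M" and y: "norm (q - q * p) \<le> M"
  shows "norm (p - q) \<le> M"
proof -
  have p: "p * p = p" "p\<^sup>\<star> = p" and q: "q * q = q" "q\<^sup>\<star> = q"
    using assms by (auto simp: projection_def)
  have pp: "p * (p * z) = p * z" and qq: "q * (q * z) = q * z" for z
    using p(1) q(1) by (simp_all flip: mult.assoc)
  have M: "0 \<le> M"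
    using x norm_ge_zero order_trans by blast
  \<comment> \<open>Formally x = p(1 - q) and y = (1 - p)q, so x*y = 0 because p(1 - p) = 0. This
    makes \<open>?a\<close> and \<open>?b\<close> orthogonal.\<close>
  let ?x = "p - p * q" and ?y = "q - p * q"
  let ?a = "?x * ?x\<^sup>\<star>" and ?b = "?y * ?y\<^sup>\<star>"
  note expand = star_diff star_add star_mult p q pp qq algebra_simps
  \<comment> \<open>The hypothesis bounds \<open>q - q * p\<close>, which is the adjoint of
    \<open>?y\<close>.\<close>
  have "norm ?y \<le> M"
    using y norm_star[of ?y] by (simp add: star_diff star_mult p q)
  then have "norm (?a + ?b) \<le> M\<^sup>2"
    using x by (intro norm_orthogonal_add_le)
      (simp_all add: norm_mult_star power_mono, simp_all add: expand star_star)
  \<comment> \<open>Here a = p - pqp and b = q - pq - qp + pqp, so the terms pqp cancel.\<close>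
  also have "?a + ?b = (p - q)\<^sup>\<star> * (p - q)"
    by (simp add: expand)
  finally show ?thesis
    using M by (simp add: cstar_identity power2_le_iff_abs_le)
qed

lemma norm_support_diff_mult_le:
  fixes u v :: "'a::cstar_algebra"
  assumes "partial_isometry u" "partial_isometry v"
  shows "norm (u\<^sup>\<star> * u - (u\<^sup>\<star> * u) * (v\<^sup>\<star> * v)) \<le> norm (u - v)"
proof -
  let ?q = "v\<^sup>\<star> * v" and ?w = "u - v"
  have "v * ?q = v"
    using assms(2) by (rule partial_isometry_mult_support)
  \<comment> \<open>Since v - vq = 0, replacing u by w = u - v does not change u - uq.\<close>
  then have "u\<^sup>\<star> * u - (u\<^sup>\<star> * u) * ?q = u\<^sup>\<star> * (?w - ?w * ?q)"
    by (simp add: left_diff_distrib right_diff_distrib mult.assoc)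
  then have "norm (u\<^sup>\<star> * u - (u\<^sup>\<star> * u) * ?q) \<le> norm u * norm (?w - ?w * ?q)"
    using norm_mult_ineq[of "u\<^sup>\<star>" "?w - ?w * ?q"] by (simp add: norm_star)
  also have "\<dots> \<le> 1 * norm ?w"
    using assms
    by (intro mult_mono norm_partial_isometry_le_1 norm_diff_mult_projection_le)
      (auto simp: partial_isometry_def)
  finally show ?thesis
    by simp
qed

theorem theorem1:
  fixes u v :: "'a::cstar_algebra"
  assumes "partial_isometry u" and "partial_isometry v"
  shows "norm (u\<^sup>\<star> * u - v\<^sup>\<star> * v) \<le> norm (u - v)"
proof (rule norm_projection_diff_le)
  show "projection (u\<^sup>\<star> * u)" "projection (v\<^sup>\<star> * v)"
    using assms by (simp_all add: partial_isometry_def)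
  show "norm (u\<^sup>\<star> * u - (u\<^sup>\<star> * u) * (v\<^sup>\<star> * v)) \<le> norm (u - v)"
    using assms by (rule norm_support_diff_mult_le)
  show "norm (v\<^sup>\<star> * v - (v\<^sup>\<star> * v) * (u\<^sup>\<star> * u)) \<le> norm (u - v)"
    using norm_support_diff_mult_le[OF assms(2,1)] by (simp add: norm_minus_commute)
qed

end
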